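(* Let $\Phi=(D,\varphi)$ be a $\mathbb{T}$-gain digraph on $n$ vertices with gain adjacency matrix $A(\Phi)$. Let $\mathcal{E}_n(D)$ denote the set of all spanning elementary subdigraphs of $D$, and for $\mathsf{E}\in\mathcal{E}_n(D)$ let $\varphi(\mathsf{E})=\prod_{C\in\mathsf{E}}\varphi(C)$ denote its gain (product over the directed cycles $C$ composing $\mathsf{E}$). Then $$\det(A(\Phi))=\sum_{\mathsf{E}\in\mathcal{E}_n(D)}(-1)^{n-c(\mathsf{E})}\varphi(\mathsf{E}).$$
   Context: A digraph $D=(V,\mathcal{A})$ has a finite vertex set $V=\{v_1,\dots,v_n\}$ and a set $\mathcal{A}$ of ordered pairs of distinct vertices, called arcs (no loops; at most one arc from $v_i$ to $v_j$ for each ordered pair; opposite arcs may both be present). A directed cycle is a closed directed walk whose vertices are distinct except that the first and last coincide (so its length is at least $2$; length $2$ is allowed). Let $\mathbb{T}=\{z\in\mathbb{C}:|z|=1\}$. A $\mathbb{T}$-gain digraph is a pair $\Phi=(D,\varphi)$ with $\varphi:\mathcal{A}\to\mathbb{T}$ an arbitrary function. Its gain adjacency matrix $A(\Phi)$ has entries $A(\Phi)_{ij}=\varphi(v_i,v_j)$ if $(v_i,v_j)\in\mathcal{A}$ and $0$ otherwise. An elementary subdigraph of $D$ is a subdigraph in which every vertex has in-degree and out-degree exactly $1$, equivalently a vertex-disjoint union of directed cycles of $D$; it is spanning if it covers all $n$ vertices. $c(\mathsf{E})$ is the number of directed cycles composing $\mathsf{E}$. The gain $\varphi(C)$ of a directed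 cycle is the product of the gains of its arcs. *)

theory Defs
  imports "Graph_Theory.Graph_Theory" "Jordan_Normal_Form.Determinant" Complex_Main
begin

text \<open>Arcs of a \<^typ>\<open>'a pair_pre_digraph\<close> are ordered pairs of vertices, so parallel arcs cannot
  occur; the locale \<^locale>\<open>pair_digraph\<close> adds finiteness and the absence of loops, while opposite
  arcs remain possible. The gain function is total in HOL, but its values outside the arc set are
  unconstrained and never used.\<close>

locale unit_gain_digraph = pair_digraph D
  for D :: "'a pair_pre_digraph" +
  fixes \<phi> :: "'a \<times> 'a \<Rightarrow> complex"
  assumes unit_gain: "a \<in> parcs D \<Longrightarrow> cmod (\<phi> a) = 1"

text \<open>The function \<open>v\<close> is the numbering of the vertices, by \<open>0, \<dots>, n - 1\<close>.\<close>

definition gain_adjacency_matrix ::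
  "'a pair_pre_digraph \<Rightarrow> ('a \<times> 'a \<Rightarrow> complex) \<Rightarrow> (nat \<Rightarrow> 'a) \<Rightarrow> complex mat" where
  "gain_adjacency_matrix D \<phi> v =
     mat (card (pverts D)) (card (pverts D))
       (\<lambda>(i, j). if (v i, v j) \<in> parcs D then \<phi> (v i, v j) else 0)"

definition elementary_subdigraph :: "'a pair_pre_digraph \<Rightarrow> 'a pair_pre_digraph \<Rightarrow> bool" where
  "elementary_subdigraph E D \<longleftrightarrow>
     subgraph (with_proj E) (with_proj D) \<and>
     (\<forall>u \<in> pverts E. in_degree (with_proj E) u = 1 \<and> out_degree (with_proj E) u = 1)"

definition spanning_elementary_subdigraphs ::
  "'a pair_pre_digraph \<Rightarrow> 'a pair_pre_digraph set" where
  "spanning_elementary_subdigraphs D =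
     {E. elementary_subdigraph E D \<and> spanning (with_proj E) (with_proj D)}"

text \<open>The library predicate \<^const>\<open>pre_digraph.cycle\<close> holds of arc lists and so distinguishes the
  starting points of a directed cycle. Passing to the subdigraph formed by the vertices and arcs of
  the list identifies these rotations. In an elementary digraph, the directed cycles it contains
  are exactly the ones composing it.\<close>

definition dicycles :: "'a pair_pre_digraph \<Rightarrow> 'a pair_pre_digraph set" where
  "dicycles E =
     {\<lparr>pverts = fst ` set p, parcs = set p\<rparr> | p. pre_digraph.cycle (with_proj E) p}"

definition dicycle_gain :: "('a \<times> 'a \<Rightarrow> complex) \<Rightarrow> 'a pair_pre_digraph \<Rightarrow> complex" where
  "dicycle_gain \<phi> C = (\<Prod>a \<in> parcs C. \<phi> a)"

definition elementary_gain :: "('a \<times> 'a \<Rightarrow> complex) \<Rightarrow> 'a pair_pre_digraph \<Rightarrow> complex" where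
  "elementary_gain \<phi> E = (\<Prod>C \<in> dicycles E. dicycle_gain \<phi> C)"

end

theory Submission
  imports Defs "HOL-Combinatorics.Orbits" "HOL-Combinatorics.Cycles"
begin

text \<open>
  In the Leibniz expansion over the permutations \<open>f\<close> of the vertex set, only those \<open>f\<close> survive all
  of whose pairs \<open>(u, f u)\<close> are arcs, and these are exactly the successor functions of the spanning
  elementary subdigraphs. The directed cycles of such a subdigraph are the orbits of \<open>f\<close>, so it
  remains to see that the sign of a permutation of \<open>n\<close> points with \<open>c\<close> orbits is \<open>(- 1) ^ (n - c)\<close>.
  This goes by induction on \<open>n\<close>: if \<open>f\<close> moves \<open>x\<close>, composing with the transposition of \<open>x\<close> and \<open>f x\<close>
  cuts \<open>x\<close> out of its orbit, which flips the sign and keeps the number of orbits of the remaining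
  points.
\<close>

section \<open>The sign of a permutation and the number of its orbits\<close>

text \<open>The composite sends \<open>x\<close> to \<open>p x\<close> and straight back to
  \<open>x\<close>, so \<open>x\<close> becomes a fixed point.\<close>

lemma permutes_transpose_comp_fixing:
  assumes "p permutes insert x S"
  shows "transpose x (p x) \<circ> p permutes S"
proof (rule permutes_superset)
  have "p x \<in> insert x S"
    using permutes_in_image[OF assms, of x] by simp
  then show "transpose x (p x) \<circ> p permutes insert x S"
    by (intro permutes_compose[OF assms] permutes_swap_id) auto
qed auto

text \<open>Away from \<open>x\<close> the composite agrees with \<open>p\<close>, except that a
  point sent to \<open>x\<close> by \<open>p\<close> now jumps directly to \<open>p x\<close>.
  Orbits are traversed as before, only skipping \<open>x\<close>.\<close>

lemma orbit_transpose_comp_fixing: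
  assumes "permutation p" and "y \<noteq> x"
  shows "orbit (transpose x (p x) \<circ> p) y = orbit p y - {x}"
proof -
  define q where "q = transpose x (p x) \<circ> p"
  have "inj p"
    using assms(1) by (simp add: permutation bij_is_inj)
  have "permutation q"
    unfolding q_def by (intro permutation_compose assms(1) permutation_swap_id)
  \<comment> \<open>By injectivity \<open>p z\<close> differs from \<open>p x\<close>, so the
    transposition acts on \<open>p z\<close> only if \<open>p z = x\<close>.\<close>
  have q: "q z = (if p z = x then p x else p z)" if "z \<noteq> x" for z
    using that inj_eq[OF \<open>inj p\<close>, of z x] by (auto simp: q_def transpose_def)
  have q_nx: "q z \<noteq> x" if "z \<noteq> x" for z
    using that inj_eq[OF \<open>inj p\<close>, of z x] inj_eq[OF \<open>inj p\<close>, of x z] by (auto simp: q)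
  have sub: "z \<in> orbit p y \<and> z \<noteq> x" if "z \<in> orbit q y" for z
    using that
  proof induction
    case base
    have "q y \<in> orbit p y"
      using assms(2) orbit.base[of p y] orbit.step[of x p y] by (auto simp: q)
    then show ?case
      using q_nx assms(2) by blast
  next
    case (step z)
    then have "q z \<in> orbit p y"
      using orbit.step[of z p y] orbit.step[of x p y] by (auto simp: q)
    then show ?case
      using q_nx step by blast
  qed
  \<comment> \<open>Since \<open>x\<close> never lies in \<open>orbit q y\<close>, the invariant at
    \<open>x\<close> speaks of the next point \<open>p x\<close> instead; this carries the induction
    across \<open>x\<close>.\<close>
  have sup: "(if z = x then p x \<in> orbit q y else z \<in> orbit q y)" if "z \<in> orbit p y" for z
    using that
  proof induction
    case base
    then show ?case
      using q[OF assms(2)] orbit.base[of q y] by auto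
  next
    case (step z)
    show ?case
    proof (cases "z = x")
      case True
      then show ?thesis
        using step.IH by auto
    next
      case False
      then show ?thesis
        using step.IH q[OF False] orbit.step[of z q y] by auto
    qed
  qed
  show ?thesis
    unfolding q_def[symmetric]
  proof (intro equalityI subsetI)
    show "z \<in> orbit p y - {x}" if "z \<in> orbit q y" for z
      using sub[OF that] by simp
    show "z \<in> orbit q y" if "z \<in> orbit p y - {x}" for z
      using sup[of z] that by simp
  qed
qed

text \<open>As \<open>x\<close> is not fixed, no orbit is just \<open>{x}\<close>, so every orbit
  keeps a point after \<open>x\<close> is deleted. That point determines the orbit, since orbits
  that meet are equal. Hence cutting out \<open>x\<close> does not change the number of
  orbits.\<close>

lemma inj_on_orbit_minus:
  assumes "permutation p" and "p x \<noteq> x"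
  shows "inj_on (\<lambda>A. A - {x}) (range (orbit p))"
proof (rule inj_onI, clarify)
  fix a b
  assume eq: "orbit p a - {x} = orbit p b - {x}"
  have ne: "orbit p a - {x} \<noteq> {}"
  proof
    assume "orbit p a - {x} = {}"
    then have "a = x" and "p a = x"
      using permutation_self_in_orbit[OF assms(1), of a] orbit.base[of p a] by auto
    then show False
      using assms(2) by simp
  qed
  then obtain c where "c \<in> orbit p a" "c \<in> orbit p b"
    using eq by blast
  then show "orbit p a = orbit p b"
    using orbit_cyclic_eq3[OF cyclic_on_orbit'[OF assms(1)]] by metis
qed

text \<open>The exponent is a sum, of the same parity as the difference, to keep truncated
  subtraction out of the induction. A fixed \<open>x\<close> adds one point and one orbit; a moved
  \<open>x\<close> adds one point and no orbit.\<close>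

lemma sign_eq_power_card_orbits_add:
  assumes "finite S" and "p permutes S"
  shows "sign p = (- 1) ^ (card S + card (orbit p ` S))"
  using assms
proof (induction S arbitrary: p rule: finite_induct)
  case empty
  then show ?case
    by simp
next
  case (insert x S)
  have perm: "permutation p"
    using insert.hyps(1) insert.prems by (auto simp: permutation_permutes)
  show ?case
  proof (cases "p x = x")
    case True
    then have pS: "p permutes S"
      using insert.prems by (auto intro: permutes_superset)
    have "orbit p x = {x}"
      using True by (simp add: orbit_eq_singleton_iff)
    \<comment> \<open>Orbits of points of \<open>S\<close> stay inside \<open>S\<close>, so
      \<open>{x}\<close> is a new orbit.\<close>
    moreover have "{x} \<notin> orbit p ` S"
      using insert.hyps(2) permutes_orbit_subset[OF pS] by fastforce
    ultimately show ?thesis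
      using insert.IH[OF pS] insert.hyps by simp
  next
    case False
    define q where "q = transpose x (p x) \<circ> p"
    have qS: "q permutes S"
      unfolding q_def by (rule permutes_transpose_comp_fixing[OF insert.prems])
    have permq: "permutation q"
      using insert.hyps(1) qS by (auto simp: permutation_permutes)
    have "p = transpose x (p x) \<circ> q"
      by (simp add: q_def fun_eq_iff)
    then have sign: "sign p = - sign q"
      using False permq
      by (metis mult_minus1 permutation_swap_id sign_compose sign_swap_id)
    \<comment> \<open>The orbit of \<open>x\<close> is already counted in \<open>S\<close>, as that
      of \<open>p x\<close>.\<close>
    have "p x \<in> S"
      using False insert.prems by (metis insertE insertI1 permutes_in_image)
    then have "orbit p x \<in> orbit p ` S"
      using permutation_orbit_step[OF perm, of x] by (metis imageI)
    then have "orbit p ` insert x S = orbit p ` S"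
      by auto
    moreover have "orbit q ` S = (\<lambda>A. A - {x}) ` orbit p ` S"
      unfolding image_image q_def
      by (intro image_cong refl orbit_transpose_comp_fixing perm) (use insert.hyps in auto)
    ultimately have "card (orbit q ` S) = card (orbit p ` insert x S)"
      using inj_on_orbit_minus[OF perm False]
      by (simp add: card_image inj_on_subset image_mono)
    then show ?thesis
      using sign insert.IH[OF qS] insert.hyps by simp
  qed
qed

text \<open>There are at most as many orbits as points, so the subtraction does not truncate and
  keeps the parity of the sum.\<close>

lemma sign_eq_power_card_orbits:
  assumes "finite S" and "p permutes S"
  shows "sign p = (- 1) ^ (card S - card (orbit p ` S))"
proof -
  have "card (orbit p ` S) \<le> card S"
    by (rule card_image_le[OF assms(1)])
  then have "even (card S + card (orbit p ` S)) = even (card S - card (orbit p ` S))"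
    by simp
  then show ?thesis
    unfolding sign_eq_power_card_orbits_add[OF assms] by (auto simp: minus_one_power_iff)
qed

section \<open>Functional digraphs\<close>

text \<open>One notion serves for both levels: with \<open>A\<close> the whole vertex set it yields
  the spanning subdigraphs, with \<open>A\<close> an orbit of \<open>f\<close> their directed
  cycles.\<close>

definition functional_digraph :: "('a \<Rightarrow> 'a) \<Rightarrow> 'a set \<Rightarrow> 'a pair_pre_digraph" where
  "functional_digraph f A = \<lparr>pverts = A, parcs = (\<lambda>u. (u, f u)) ` A\<rparr>"

lemma functional_digraph_simps [simp]:
  "pverts (functional_digraph f A) = A"
  "parcs (functional_digraph f A) = (\<lambda>u. (u, f u)) ` A"
  by (simp_all add: functional_digraph_def)

lemma pcas_append: "pcas u (p @ q) w \<longleftrightarrow> (\<exists>x. pcas u p x \<and> pcas x q w)"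
  by (induction p arbitrary: u) auto

lemma pcas_iterate:
  "pcas x (map (\<lambda>i. ((f ^^ i) x, (f ^^ Suc i) x)) [0..<k]) ((f ^^ k) x)"
  by (induction k) (auto simp: pcas_append)

text \<open>When all arcs follow \<open>f\<close>, each arc is determined by its tail, so a walk is
  determined by its start and its length.\<close>

lemma pcas_functional_imp_iterate:
  assumes "pcas x p y" and "\<And>e. e \<in> set p \<Longrightarrow> snd e = f (fst e)"
  shows "map fst p = map (\<lambda>i. (f ^^ i) x) [0..<length p] \<and> y = (f ^^ length p) x"
  using assms
proof (induction p arbitrary: y rule: rev_induct)
  case Nil
  then show ?case
    by simp
next
  case (snoc e p)
  then have "pcas x p (fst e)" and "snd e = y"
    by (auto simp: pcas_append)
  moreover have "snd e = f (fst e)"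
    using snoc.prems(2) by simp
  ultimately show ?case
    using snoc.IH[of "fst e"] snoc.prems(2) by auto
qed

lemma pawalk_verts_eq: "pcas u p w \<Longrightarrow> pawalk_verts u p = u # map snd p"
  by (induction p arbitrary: u) auto

text \<open>The library demands distinctness of the tail of the vertex list, which is the list of
  heads of the arcs.\<close>

lemma cycle_with_proj_iff:
  "pre_digraph.cycle (with_proj E) p \<longleftrightarrow>
    (\<exists>u \<in> pverts E. set p \<subseteq> parcs E \<and> pcas u p u \<and> distinct (map snd p) \<and> p \<noteq> [])"
  unfolding pre_digraph.cycle_def pre_digraph.awalk_def cas_with_proj_eq awalk_verts_with_proj_eq
  by (auto simp: pawalk_verts_eq)

text \<open>A nonempty closed walk along \<open>f\<close> from \<open>u\<close> visits exactly the
  orbit of \<open>u\<close>; conversely, iterating \<open>f\<close> from \<open>u\<close> for one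
  least period traces a cycle through that orbit. Fixed points of \<open>f\<close> are allowed and
  count as cycles of length 1.\<close>

lemma dicycles_functional_digraph:
  assumes "finite V" and "f permutes V"
  shows "dicycles (functional_digraph f V) = functional_digraph f ` orbit f ` V"
proof (intro equalityI subsetI)
  fix C assume "C \<in> dicycles (functional_digraph f V)"
  then obtain p u where C: "C = \<lparr>pverts = fst ` set p, parcs = set p\<rparr>"
    and u: "u \<in> V" and p: "set p \<subseteq> (\<lambda>u. (u, f u)) ` V" "pcas u p u" "p \<noteq> []"
    by (auto simp: dicycles_def cycle_with_proj_iff)
  have "snd e = f (fst e)" if "e \<in> set p" for e
    using p(1) that by auto
  note walk = pcas_functional_imp_iterate[OF p(2) this]
  \<comment> \<open>The walk is closed and nonempty, so its length is a positive period of
    \<open>u\<close>, and the iterates below it exhaust the orbit.\<close>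
  then have "orbit f u = {(f ^^ m) u |m. m < length p}"
    using p(3) by (intro orbit_altdef_bounded) auto
  also have "\<dots> = set (map fst p)"
    using walk by auto
  finally have "fst ` set p = orbit f u"
    by simp
  moreover have "set p = (\<lambda>u. (u, f u)) ` fst ` set p"
    using p(1) by (force simp: image_iff)
  ultimately have "C = functional_digraph f (orbit f u)"
    by (simp add: C functional_digraph_def)
  then show "C \<in> functional_digraph f ` orbit f ` V"
    using u by blast
next
  fix C assume "C \<in> functional_digraph f ` orbit f ` V"
  then obtain u where u: "u \<in> V" and C: "C = functional_digraph f (orbit f u)"
    by blast
  have perm: "permutation f"
    using assms by (auto simp: permutation_permutes)
  define k where "k = least_power f u"
  have k: "(f ^^ k) u = u" "k > 0"
    using least_power_of_permutation[OF perm] by (auto simp: k_def)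
  define p where "p = map (\<lambda>i. ((f ^^ i) u, (f ^^ Suc i) u)) [0..<k]"
  have orbit: "orbit f u = (\<lambda>i. (f ^^ i) u) ` {0..<k}"
    using orbit_altdef_bounded[OF k] by auto
  have set_p: "set p = (\<lambda>u. (u, f u)) ` orbit f u"
    unfolding p_def orbit by (auto simp: image_image)
  have "pcas u p u"
    using pcas_iterate[of u f k] by (simp only: p_def k)
  moreover have "distinct (map snd p)"
  proof -
    \<comment> \<open>The tails are the iterates below the least period, hence distinct; the heads
      are their images under the injective \<open>f\<close>.\<close>
    have "map snd p = map f (support f u)"
      by (simp add: p_def k_def)
    then show ?thesis
      using cycle_of_permutation[OF perm, of u] permutes_inj[OF assms(2)]
      by (metis distinct_map inj_on_subset subset_UNIV)
  qed
  moreover have "p \<noteq> []"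
    using k by (simp add: p_def)
  moreover have "set p \<subseteq> (\<lambda>u. (u, f u)) ` V"
    unfolding set_p using permutes_orbit_subset[OF assms(2) u] by blast
  ultimately have "pre_digraph.cycle (with_proj (functional_digraph f V)) p"
    using u by (auto simp: cycle_with_proj_iff)
  moreover have "C = \<lparr>pverts = fst ` set p, parcs = set p\<rparr>"
    unfolding set_p C functional_digraph_def by (simp add: image_image)
  ultimately show "C \<in> dicycles (functional_digraph f V)"
    unfolding dicycles_def by blast
qed

lemma inj_functional_digraph: "inj (functional_digraph f)"
  by (auto intro!: injI simp: functional_digraph_def)

lemma card_dicycles_functional_digraph:
  assumes "finite V" and "f permutes V"
  shows "card (dicycles (functional_digraph f V)) = card (orbit f ` V)"
  unfolding dicycles_functional_digraph[OF assms]
  by (intro card_image inj_on_subset[OF inj_functional_digraph]) simp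

text \<open>The orbits partition \<open>V\<close>, and each vertex stands for the single arc leaving
  it, so the product over cycles of products over arcs collapses to one product over
  \<open>V\<close>.\<close>

lemma elementary_gain_functional_digraph:
  assumes "finite V" and "f permutes V"
  shows "elementary_gain \<phi> (functional_digraph f V) = (\<Prod>u\<in>V. \<phi> (u, f u))"
proof -
  have perm: "permutation f"
    using assms by (auto simp: permutation_permutes)
  have "elementary_gain \<phi> (functional_digraph f V) =
      (\<Prod>A\<in>orbit f ` V. dicycle_gain \<phi> (functional_digraph f A))"
    unfolding elementary_gain_def dicycles_functional_digraph[OF assms]
    by (subst prod.reindex) (auto intro: inj_on_subset[OF inj_functional_digraph])
  also have "\<dots> = (\<Prod>A\<in>orbit f ` V. \<Prod>u\<in>A. \<phi> (u, f u))"
    by (intro prod.cong refl) (simp add: dicycle_gain_def prod.reindex inj_on_def)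
  also have "\<dots> = (\<Prod>u\<in>\<Union>(orbit f ` V). \<phi> (u, f u))"
  proof -
    have "A = B" if AB: "A \<in> orbit f ` V" "B \<in> orbit f ` V" and z: "z \<in> A" "z \<in> B" for A B z
    proof -
      have "cyclic_on f A" "cyclic_on f B"
        using AB cyclic_on_orbit'[OF perm] by auto
      then show ?thesis
        using z orbit_cyclic_eq3 by metis
    qed
    then have "\<forall>A\<in>orbit f ` V. \<forall>B\<in>orbit f ` V. A \<noteq> B \<longrightarrow> A \<inter> B = {}"
      by (intro ballI impI equals0I) (elim IntE notE)
    moreover have "\<forall>A\<in>orbit f ` V. finite A"
      using finite_orbit[OF permutation_self_in_orbit[OF perm]] by simp
    ultimately show ?thesis
      by (simp only: prod.Union_disjoint o_def)
  qed
  also have "\<Union>(orbit f ` V) = V"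
  proof (intro equalityI subsetI)
    show "x \<in> V" if "x \<in> \<Union>(orbit f ` V)" for x
      using that permutes_orbit_subset[OF assms(2)] by fast
    show "x \<in> \<Union>(orbit f ` V)" if "x \<in> V" for x
      using that permutation_self_in_orbit[OF perm, of x] by (rule UN_I)
  qed
  finally show ?thesis .
qed

section \<open>Spanning elementary subdigraphs as permutations\<close>

text \<open>Infinite sets have \<open>card\<close> 0, so degree 1 means a unique arc for arbitrary
  \<open>E\<close>.\<close>

lemma in_degree_eq_1_iff:
  "in_degree (with_proj E) u = 1 \<longleftrightarrow> (\<exists>!w. (w, u) \<in> parcs E)"
proof -
  have "in_arcs (with_proj E) u = (\<lambda>w. (w, u)) ` {w. (w, u) \<in> parcs E}"
    by (auto simp: in_arcs_def)
  then have "in_degree (with_proj E) u = card {w. (w, u) \<in> parcs E}"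
    by (simp add: in_degree_def card_image inj_on_def)
  then show ?thesis
    by (simp add: card_1_singleton_iff Ex1_def set_eq_iff) blast
qed

lemma out_degree_eq_1_iff:
  "out_degree (with_proj E) u = 1 \<longleftrightarrow> (\<exists>!w. (u, w) \<in> parcs E)"
proof -
  have "out_arcs (with_proj E) u = (\<lambda>w. (u, w)) ` {w. (u, w) \<in> parcs E}"
    by (auto simp: out_arcs_def)
  then have "out_degree (with_proj E) u = card {w. (u, w) \<in> parcs E}"
    by (simp add: out_degree_def card_image inj_on_def)
  then show ?thesis
    by (simp add: card_1_singleton_iff Ex1_def set_eq_iff) blast
qed

text \<open>The well-formedness of \<open>E\<close> contained in \<open>subgraph\<close> is
  inherited from \<open>D\<close>: the arcs of \<open>E\<close> are arcs of \<open>D\<close>, with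
  ends in the common vertex set.\<close>

lemma spanning_elementary_subdigraphs_iff:
  assumes "pair_wf_digraph D"
  shows "E \<in> spanning_elementary_subdigraphs D \<longleftrightarrow>
    pverts E = pverts D \<and> parcs E \<subseteq> parcs D \<and>
    (\<forall>u \<in> pverts D. (\<exists>!w. (w, u) \<in> parcs E) \<and> (\<exists>!w. (u, w) \<in> parcs E))"
proof -
  interpret pair_wf_digraph D by fact
  have "pair_wf_digraph E" if "pverts E = pverts D" "parcs E \<subseteq> parcs D"
    using that wellformed' by unfold_locales (metis prod.collapse subsetD)+
  then have "E \<in> spanning_elementary_subdigraphs D \<longleftrightarrow>
    pverts E = pverts D \<and> parcs E \<subseteq> parcs D \<and>
    (\<forall>u \<in> pverts E. (\<exists>!w. (w, u) \<in> parcs E) \<and> (\<exists>!w. (u, w) \<in> parcs E))"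
    using assms
    unfolding spanning_elementary_subdigraphs_def elementary_subdigraph_def spanning_def
      subgraph_def compatible_def in_degree_eq_1_iff out_degree_eq_1_iff wf_digraph_wp_iff
      with_proj_simps mem_Collect_eq
    by (intro iffI conjI; (elim conjE)?; (assumption | simp)?)
  then show ?thesis
    by (simp cong: conj_cong)
qed

text \<open>Out-degree 1 makes the arc set the graph of a function on the vertices, in-degree 1
  makes this function injective, and finiteness makes it a permutation.\<close>

lemma bij_betw_functional_digraph:
  assumes "pair_fin_digraph D"
  shows "bij_betw (\<lambda>f. functional_digraph f (pverts D))
    {f. f permutes pverts D \<and> (\<forall>u \<in> pverts D. (u, f u) \<in> parcs D)}
    (spanning_elementary_subdigraphs D)"
proof (rule bij_betw_imageI)
  interpret pair_fin_digraph D by fact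
  note mem_iff = spanning_elementary_subdigraphs_iff[OF pair_wf_digraph_axioms]
  let ?V = "pverts D"
  let ?P = "{f. f permutes ?V \<and> (\<forall>u \<in> ?V. (u, f u) \<in> parcs D)}"
  show "inj_on (\<lambda>f. functional_digraph f ?V) ?P"
  proof (rule inj_onI, clarify)
    fix f g
    assume fg: "f permutes ?V" "g permutes ?V"
      and eq: "functional_digraph f ?V = functional_digraph g ?V"
    have graph: "(\<lambda>u. (u, f u)) ` ?V = (\<lambda>u. (u, g u)) ` ?V"
      using eq by (simp add: functional_digraph_def)
    show "f = g"
    proof
      fix u show "f u = g u"
        using graph fg by (cases "u \<in> ?V") (auto simp: permutes_not_in)
    qed
  qed
  show "(\<lambda>f. functional_digraph f ?V) ` ?P = spanning_elementary_subdigraphs D"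
  proof (intro equalityI subsetI)
    fix E assume "E \<in> (\<lambda>f. functional_digraph f ?V) ` ?P"
    then obtain f where f: "f permutes ?V" "\<forall>u \<in> ?V. (u, f u) \<in> parcs D"
      and E: "E = functional_digraph f ?V"
      by blast
    have "\<exists>!w. (w, u) \<in> parcs E" if "u \<in> ?V" for u
    proof -
      obtain w where w: "f w = u" "\<And>w'. f w' = u \<Longrightarrow> w' = w"
        using permutes_bij[OF f(1)] by (metis bij_pointE)
      have "w \<in> ?V"
        using that unfolding w(1)[symmetric] permutes_in_image[OF f(1)] .
      show ?thesis
      proof (rule ex1I)
        show "(w, u) \<in> parcs E"
          using w(1) \<open>w \<in> ?V\<close> by (auto simp: E)
        show "w' = w" if "(w', u) \<in> parcs E" for w'
          using that by (intro w(2)) (auto simp: E)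
      qed
    qed
    then show "E \<in> spanning_elementary_subdigraphs D"
      using f by (auto simp: mem_iff E)
  next
    fix E assume "E \<in> spanning_elementary_subdigraphs D"
    then have E: "pverts E = ?V" "parcs E \<subseteq> parcs D"
      and inn: "\<And>u. u \<in> ?V \<Longrightarrow> \<exists>!w. (w, u) \<in> parcs E"
      and out: "\<And>u. u \<in> ?V \<Longrightarrow> \<exists>!w. (u, w) \<in> parcs E"
      by (auto simp: mem_iff)
    \<comment> \<open>Out-degree 1 justifies \<open>THE\<close>; the value \<open>u\<close> outside
      the vertex set is what \<open>permutes\<close> demands.\<close>
    define f where "f u = (if u \<in> ?V then THE w. (u, w) \<in> parcs E else u)" for u
    have f: "(u, f u) \<in> parcs E" if "u \<in> ?V" for u
      using theI'[OF out[OF that]] that by (simp add: f_def)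
    have f_eq: "w = f u" if "(u, w) \<in> parcs E" for u w
      using that out f E(2) in_arcsD1 by (metis subsetD)
    have fV: "f u \<in> ?V" if "u \<in> ?V" for u
      using f[OF that] E(2) in_arcsD2 by blast
    have "inj_on f ?V"
      using inn f fV by (metis inj_onI)
    then have "bij_betw f ?V ?V"
      using pair_finite_verts fV by (simp add: bij_betw_def endo_inj_surj image_subsetI)
    then have "f permutes ?V"
      by (rule bij_imp_permutes) (simp add: f_def)
    moreover have "parcs E = (\<lambda>u. (u, f u)) ` ?V"
      using f f_eq E(2) in_arcsD1 by fast
    then have "E = functional_digraph f ?V"
      using E(1) by (simp add: functional_digraph_def)
    ultimately show "E \<in> (\<lambda>f. functional_digraph f ?V) ` ?P"
      using f E(2) by blast
  qed
qed

section \<open>The Leibniz expansion\<close>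

text \<open>\<open>map_permutation\<close> conjugates by \<open>f\<close>; conjugation by the
  inverse of \<open>f\<close> undoes it.\<close>

lemma bij_betw_map_permutation:
  assumes "bij_betw f A B"
  shows "bij_betw (map_permutation A f) {p. p permutes A} {p. p permutes B}"
proof (rule bij_betw_byWitness[where f' = "map_permutation B (inv_into A f)"])
  have inv: "bij_betw (inv_into A f) B A"
    by (rule bij_betw_inv_into[OF assms])
  show "\<forall>p\<in>{p. p permutes A}. map_permutation B (inv_into A f) (map_permutation A f p) = p"
    using assms by (auto intro!: map_permutation_compose_inv simp: bij_betw_inv_into_left)
  show "\<forall>p\<in>{p. p permutes B}. map_permutation A f (map_permutation B (inv_into A f) p) = p"
    using assms by (auto intro!: map_permutation_compose_inv[OF inv] simp: bij_betw_inv_into_right)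
  show "map_permutation A f ` {p. p permutes A} \<subseteq> {p. p permutes B}"
    using map_permutation_permutes[OF assms] by blast
  show "map_permutation B (inv_into A f) ` {p. p permutes B} \<subseteq> {p. p permutes A}"
    using map_permutation_permutes[OF inv] by blast
qed

text \<open>Conjugating by the numbering \<open>v\<close> turns permutations of indices into
  permutations of \<open>V\<close> with the same sign, so the Leibniz formula can be read on the
  vertices themselves.\<close>

lemma det_mat_numbering:
  fixes a :: "'a \<Rightarrow> 'a \<Rightarrow> 'b :: comm_ring_1"
  assumes "bij_betw v {0..<n} V"
  shows "det (mat n n (\<lambda>(i, j). a (v i) (v j))) =
    (\<Sum>p | p permutes V. of_int (sign p) * (\<Prod>u\<in>V. a u (p u)))"
proof -
  have inj: "inj_on v {0..<n}"
    using assms by (simp add: bij_betw_def)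
  have "det (mat n n (\<lambda>(i, j). a (v i) (v j))) =
      (\<Sum>p | p permutes {0..<n}. of_int (sign p) * (\<Prod>i = 0..<n. a (v i) (v (p i))))"
    unfolding det_def
    by (auto intro!: sum.cong prod.cong dest: permutes_in_image)
  also have "\<dots> = (\<Sum>p | p permutes {0..<n}. of_int (sign (map_permutation {0..<n} v p)) *
      (\<Prod>u\<in>V. a u (map_permutation {0..<n} v p u)))"
  proof (intro sum.cong refl, clarify)
    fix p :: "nat \<Rightarrow> nat" assume p: "p permutes {0..<n}"
    have "(\<Prod>u\<in>V. a u (map_permutation {0..<n} v p u)) =
        (\<Prod>i = 0..<n. a (v i) (map_permutation {0..<n} v p (v i)))"
      by (rule prod.reindex_bij_betw[OF assms, symmetric])
    then show "of_int (sign p) * (\<Prod>i = 0..<n. a (v i) (v (p i))) =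
        of_int (sign (map_permutation {0..<n} v p)) *
        (\<Prod>u\<in>V. a u (map_permutation {0..<n} v p u))"
      using p inj by (simp add: sign_map_permutation map_permutation_apply)
  qed
  also have "\<dots> = (\<Sum>p | p permutes V. of_int (sign p) * (\<Prod>u\<in>V. a u (p u)))"
    by (rule sum.reindex_bij_betw[OF bij_betw_map_permutation[OF assms]])
  finally show ?thesis .
qed

theorem theorem2p4:
  fixes D :: "'a pair_pre_digraph" and \<phi> :: "'a \<times> 'a \<Rightarrow> complex"
    and v :: "nat \<Rightarrow> 'a" and n :: nat
  assumes "unit_gain_digraph D \<phi>"
    and "n = card (pverts D)"
    and "bij_betw v {0..<n} (pverts D)"
  shows "det (gain_adjacency_matrix D \<phi> v) =
    (\<Sum>E \<in> spanning_elementary_subdigraphs D.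
      (-1) ^ (n - card (dicycles E)) * elementary_gain \<phi> E)"
proof -
  interpret unit_gain_digraph D \<phi> by fact
  let ?V = "pverts D"
  let ?a = "\<lambda>u w. if (u, w) \<in> parcs D then \<phi> (u, w) else 0"
  let ?P = "{f. f permutes ?V \<and> (\<forall>u \<in> ?V. (u, f u) \<in> parcs D)}"
  have fin: "finite ?V"
    by (rule pair_finite_verts)
  have "det (gain_adjacency_matrix D \<phi> v) =
      (\<Sum>f | f permutes ?V. of_int (sign f) * (\<Prod>u\<in>?V. ?a u (f u)))"
    unfolding gain_adjacency_matrix_def assms(2)[symmetric]
    by (rule det_mat_numbering[OF assms(3)])
  also have "\<dots> = (\<Sum>f\<in>?P. of_int (sign f) * (\<Prod>u\<in>?V. ?a u (f u)))"
    \<comment> \<open>A permutation outside \<open>?P\<close> has some \<open>u\<close> for which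
      \<open>(u, f u)\<close> is not an arc, and the factor at \<open>u\<close> is 0.\<close>
    by (intro sum.mono_neutral_right finite_permutations fin) (auto simp: fin)
  also have "\<dots> = (\<Sum>f\<in>?P. (-1) ^ (n - card (dicycles (functional_digraph f ?V))) *
      elementary_gain \<phi> (functional_digraph f ?V))"
  proof (intro sum.cong refl)
    fix f assume f: "f \<in> ?P"
    then have "(\<Prod>u\<in>?V. ?a u (f u)) = (\<Prod>u\<in>?V. \<phi> (u, f u))"
      by (intro prod.cong) auto
    then show "of_int (sign f) * (\<Prod>u\<in>?V. ?a u (f u)) =
        (-1) ^ (n - card (dicycles (functional_digraph f ?V))) *
        elementary_gain \<phi> (functional_digraph f ?V)"
      using f fin assms(2)
      by (simp add: card_dicycles_functional_digraph elementary_gain_functional_digraph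
          sign_eq_power_card_orbits[OF fin])
  qed
  also have "\<dots> = (\<Sum>E \<in> spanning_elementary_subdigraphs D.
      (-1) ^ (n - card (dicycles E)) * elementary_gain \<phi> E)"
    by (rule sum.reindex_bij_betw[OF bij_betw_functional_digraph]) unfold_locales
  finally show ?thesis .
qed

end
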